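(* There is an algorithm that, given an interval graph $G$ with $n=|V(G)|$ and $m=|E(G)|$ together with an interval representation of $G$, solves the Maximum Edge Open Packing problem on $G$ (that is, finds an edge open packing of $G$ of maximum cardinality $\rho_e^o(G)$) in $O(n^2+m^2)$ time. In particular, the problem can be solved in $O(n^4)$ time in terms of $n$.
   Context: All graphs are finite, simple and undirected. Two distinct edges $e_1,e_2\in E(G)$ have a common edge if there is an edge $e\in E(G)\setminus\{e_1,e_2\}$ joining an endpoint of $e_1$ to an endpoint of $e_2$. A set $D\subseteq E(G)$ is an edge open packing if no two edges of $D$ have a common edge. The edge open packing number $\rho_e^o(G)$ is the maximum cardinality of an edge open packing of $G$. The Maximum Edge Open Packing problem asks for an edge open packing of maximum cardinality. A graph $G$ is an interval graph if one can assign to each vertex $v$ a closed real interval $I(v)=[L(v),R(v)]$ such that two distinct vertices are adjacent precisely when their intervals intersect; such an assignment is an interval representation of $G$. *)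

theory Defs
  imports Complex_Main "HOL-Library.Landau_Symbols"
begin

section \<open>Graphs, interval representations, edge open packings\<close>

definition simple_graph :: "'a set \<Rightarrow> 'a set set \<Rightarrow> bool" where
  "simple_graph V E \<longleftrightarrow> finite V \<and> (\<forall>e\<in>E. e \<subseteq> V \<and> card e = 2)"

definition interval_representation ::
  "'a set \<Rightarrow> 'a set set \<Rightarrow> ('a \<Rightarrow> real) \<Rightarrow> ('a \<Rightarrow> real) \<Rightarrow> bool" where
  "interval_representation V E l r \<longleftrightarrow>
     (\<forall>v\<in>V. l v \<le> r v) \<and>
     (\<forall>u\<in>V. \<forall>v\<in>V. u \<noteq> v \<longrightarrow> ({u, v} \<in> E \<longleftrightarrow> {l u..r u} \<inter> {l v..r v} \<noteq> {}))"

definition have_common_edge :: "'a set set \<Rightarrow> 'a set \<Rightarrow> 'a set \<Rightarrow> bool" where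
  "have_common_edge E e1 e2 \<longleftrightarrow> (\<exists>e\<in>E - {e1, e2}. \<exists>u\<in>e1. \<exists>v\<in>e2. e = {u, v})"

definition edge_open_packing :: "'a set set \<Rightarrow> 'a set set \<Rightarrow> bool" where
  "edge_open_packing E D \<longleftrightarrow>
     D \<subseteq> E \<and> (\<forall>e1\<in>D. \<forall>e2\<in>D. e1 \<noteq> e2 \<longrightarrow> \<not> have_common_edge E e1 e2)"

definition eop_number :: "'a set set \<Rightarrow> nat" where
  "eop_number E = Max (card ` {D. edge_open_packing E D})"

section \<open>Algorithms: structured random access programs with unit-cost operations\<close>

text \<open>
  The memory is a family of arrays of natural numbers; a scalar variable is cell 0 of an array.
  A program mentions only finitely many array names, so interleaving its arrays turns it into a
  program for the usual random access machine with constant-factor overhead. Arithmetic is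
  restricted to addition and truncated subtraction (no unit-cost multiplication or division).
  Real numbers occur only in read-only input arrays, and the only operation on them is the
  comparison of two entries.
\<close>

type_synonym name = string
type_synonym mem = "name \<Rightarrow> nat \<Rightarrow> nat"
type_synonym reals = "name \<Rightarrow> nat \<Rightarrow> real"

datatype aexp =
    Num nat
  | Cell name aexp
  | Plus aexp aexp
  | Minus aexp aexp

datatype bexp =
    Less aexp aexp
  | RLess name aexp name aexp
  | Not bexp
  | And bexp bexp

datatype com =
    Skip
  | Assign name aexp aexp
  | Seq com com
  | If bexp com com
  | While bexp com

fun aval :: "aexp \<Rightarrow> mem \<Rightarrow> nat" where
  "aval (Num k) s = k"
| "aval (Cell a e) s = s a (aval e s)"
| "aval (Plus e f) s = aval e s + aval f s"
| "aval (Minus e f) s = aval e s - aval f s"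

fun bval :: "reals \<Rightarrow> bexp \<Rightarrow> mem \<Rightarrow> bool" where
  "bval \<rho> (Less e f) s \<longleftrightarrow> aval e s < aval f s"
| "bval \<rho> (RLess a e b f) s \<longleftrightarrow> \<rho> a (aval e s) < \<rho> b (aval f s)"
| "bval \<rho> (Not b) s \<longleftrightarrow> \<not> bval \<rho> b s"
| "bval \<rho> (And b c) s \<longleftrightarrow> bval \<rho> b s \<and> bval \<rho> c s"

fun acost :: "aexp \<Rightarrow> nat" where
  "acost (Num k) = 1"
| "acost (Cell a e) = 1 + acost e"
| "acost (Plus e f) = 1 + acost e + acost f"
| "acost (Minus e f) = 1 + acost e + acost f"

fun bcost :: "bexp \<Rightarrow> nat" where
  "bcost (Less e f) = 1 + acost e + acost f"
| "bcost (RLess a e b f) = 1 + acost e + acost f"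
| "bcost (Not b) = 1 + bcost b"
| "bcost (And b c) = 1 + bcost b + bcost c"

text \<open>
  \<open>exec \<rho> c s t s'\<close>: on the real input \<open>\<rho>\<close>, the program \<open>c\<close> started in memory \<open>s\<close> halts after
  exactly \<open>t\<close> steps in memory \<open>s'\<close>. The program \<open>Assign a i e\<close> stands for \<open>a[i] := e\<close>.
\<close>

inductive exec :: "reals \<Rightarrow> com \<Rightarrow> mem \<Rightarrow> nat \<Rightarrow> mem \<Rightarrow> bool" for \<rho> :: reals where
  Skip: "exec \<rho> Skip s 1 s"
| Assign: "exec \<rho> (Assign a i e) s (1 + acost i + acost e)
             (s(a := (s a)(aval i s := aval e s)))"
| Seq: "\<lbrakk>exec \<rho> c s t s'; exec \<rho> d s' t' s''\<rbrakk> \<Longrightarrow> exec \<rho> (Seq c d) s (t + t') s''"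
| IfTrue: "\<lbrakk>bval \<rho> b s; exec \<rho> c s t s'\<rbrakk> \<Longrightarrow> exec \<rho> (If b c d) s (1 + bcost b + t) s'"
| IfFalse: "\<lbrakk>\<not> bval \<rho> b s; exec \<rho> d s t s'\<rbrakk> \<Longrightarrow> exec \<rho> (If b c d) s (1 + bcost b + t) s'"
| WhileFalse: "\<not> bval \<rho> b s \<Longrightarrow> exec \<rho> (While b c) s (1 + bcost b) s"
| WhileTrue: "\<lbrakk>bval \<rho> b s; exec \<rho> c s t s'; exec \<rho> (While b c) s' t' s''\<rbrakk>
    \<Longrightarrow> exec \<rho> (While b c) s (1 + bcost b + t + t') s''"

section \<open>Input and output\<close>

text \<open>
  The vertices are numbered from 0 to \<open>n - 1\<close>. The edges are given as a list of pairs, each edge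
  listed once, in any order and with either orientation.
\<close>

definition edge_list :: "nat set set \<Rightarrow> (nat \<times> nat) list \<Rightarrow> bool" where
  "edge_list E es \<longleftrightarrow> (\<lambda>(u, v). {u, v}) ` set es = E \<and> length es = card E"

definition input_mem :: "nat \<Rightarrow> (nat \<times> nat) list \<Rightarrow> mem" where
  "input_mem n es = (\<lambda>a i.
     if a = ''n'' \<and> i = 0 then n
     else if a = ''m'' \<and> i = 0 then length es
     else if a = ''src'' \<and> i < length es then fst (es ! i)
     else if a = ''dst'' \<and> i < length es then snd (es ! i)
     else 0)"

definition input_reals :: "nat \<Rightarrow> (nat \<Rightarrow> real) \<Rightarrow> (nat \<Rightarrow> real) \<Rightarrow> reals" where
  "input_reals n l r = (\<lambda>a i.
     if a = ''L'' \<and> i < n then l i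
     else if a = ''R'' \<and> i < n then r i
     else 0)"

definition output_edges :: "mem \<Rightarrow> nat set set" where
  "output_edges s = {{s ''outsrc'' i, s ''outdst'' i} | i. i < s ''k'' 0}"

definition solves_MEOP_on_interval_graphs_in_time :: "com \<Rightarrow> (nat \<Rightarrow> nat \<Rightarrow> nat) \<Rightarrow> bool" where
  "solves_MEOP_on_interval_graphs_in_time P T \<longleftrightarrow>
     (\<forall>n E es l r.
        simple_graph {..<n} E \<and> interval_representation {..<n} E l r \<and> edge_list E es \<longrightarrow>
        (\<exists>t s. exec (input_reals n l r) P (input_mem n es) t s \<and>
               t \<le> T n (card E) \<and>
               edge_open_packing E (output_edges s) \<and>
               card (output_edges s) = eop_number E))"

end

theory Submission
  imports Defs "HOL-Combinatorics.Transposition"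
begin

text \<open>
  The components of an edge open packing are induced stars whose unions of intervals are pairwise
  disjoint, and the leaves of a star are pairwise disjoint intervals. Orient every edge from centre
  to leaf and say that \<open>(c, x)\<close> is before \<open>(d, y)\<close> if \<open>x\<close> lies to the left of \<open>y\<close> and either \<open>c = d\<close>
  or both \<open>c\<close> and \<open>x\<close> lie to the left of both \<open>d\<close> and \<open>y\<close>. This relation is transitive, and edge
  open packings are exactly the chains of oriented edges. As the right endpoint of the leaf increases
  along a chain, sorting the \<open>2m\<close> oriented edges by it and then computing for each of them the
  length of a longest chain ending there takes quadratic time in \<open>m\<close>.
\<close>

section \<open>Chains of oriented edges\<close>

fun before :: "('a \<Rightarrow> real) \<Rightarrow> ('a \<Rightarrow> real) \<Rightarrow> 'a \<times> 'a \<Rightarrow> 'a \<times> 'a \<Rightarrow> bool" where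
  "before l r (c, x) (d, y) \<longleftrightarrow>
     r x < l y \<and> (c = d \<or> r c < l d \<and> r c < l y \<and> r x < l d)"

text \<open>The nonempty intervals of the middle edge bridge the inequalities. If just one of the
  two steps keeps its centre, the strict inequalities of the other step separate \<open>c\<close>
  from \<open>e\<close>.\<close>

lemma before_trans:
  assumes "before l r (c, x) (d, y)" "before l r (d, y) (e, z)" "l d \<le> r d" "l y \<le> r y"
  shows "before l r (c, x) (e, z)"
  using assms by auto

text \<open>The arrays of \<open>input_reals\<close> agree with the given endpoints on the vertices
  only, so the representation has to be carried over to them.\<close>

lemma interval_representation_cong:
  assumes "\<And>v. v \<in> V \<Longrightarrow> l v = l' v" "\<And>v. v \<in> V \<Longrightarrow> r v = r' v"
  shows "interval_representation V E l r \<longleftrightarrow> interval_representation V E l' r'"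
  unfolding interval_representation_def
  by (intro arg_cong2[of _ _ _ _ "(\<and>)"] ball_cong refl) (simp_all add: assms)

section \<open>From chains to edge open packings\<close>

lemma have_common_edge_sym: "have_common_edge E e1 e2 \<Longrightarrow> have_common_edge E e2 e1"
  unfolding have_common_edge_def by (metis insert_commute)

lemma simple_graphD:
  assumes "simple_graph V E" "{u, v} \<in> E"
  shows "u \<in> V" "v \<in> V" "u \<noteq> v"
  using assms unfolding simple_graph_def by (auto simp: card_2_iff)

lemma interval_adjacent_iff:
  assumes "interval_representation V E l r" "simple_graph V E" "u \<in> V" "v \<in> V"
  shows "{u, v} \<in> E \<longleftrightarrow> u \<noteq> v \<and> l u \<le> r v \<and> l v \<le> r u"
proof (cases "u = v")
  case True
  then show ?thesis using simple_graphD(3)[OF assms(2), of u v] by auto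
next
  case False
  have "l u \<le> r u" "l v \<le> r v"
    using assms unfolding interval_representation_def by auto
  moreover have "{u, v} \<in> E \<longleftrightarrow> {l u..r u} \<inter> {l v..r v} \<noteq> {}"
    using assms False unfolding interval_representation_def by auto
  ultimately show ?thesis using False by (auto simp: max_def min_def split: if_splits)
qed

text \<open>A joining edge needs two intersecting intervals. If \<open>c\<close> and
  \<open>d\<close> differ, all four cross pairs are separated. If \<open>c = d\<close>, only an edge
  between the two leaves would be new, and the leaves are separated.\<close>

lemma before_no_common_edge:
  assumes rep: "interval_representation V E l r" and G: "simple_graph V E"
    and e: "{c, x} \<in> E" and f: "{d, y} \<in> E" and b: "before l r (c, x) (d, y)"
  shows "{c, x} \<noteq> {d, y}" "\<not> have_common_edge E {c, x} {d, y}"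
proof -
  note adj = interval_adjacent_iff[OF rep G]
  have V: "c \<in> V" "x \<in> V" "d \<in> V" "y \<in> V"
    using simple_graphD[OF G] e f by blast+
  have le: "l v \<le> r v" if "v \<in> V" for v
    using rep that unfolding interval_representation_def by auto
  have n: "{u, v} \<in> E \<Longrightarrow> l u \<le> r v \<and> l v \<le> r u \<and> u \<noteq> v" if "u \<in> V" "v \<in> V" for u v
    using adj that by auto
  show "{c, x} \<noteq> {d, y}"
    using b le[OF V(1)] le[OF V(2)] by (auto simp: doubleton_eq_iff)
  show "\<not> have_common_edge E {c, x} {d, y}"
  proof
    assume "have_common_edge E {c, x} {d, y}"
    then obtain u v where uv: "{u, v} \<in> E" "{u, v} \<noteq> {c, x}" "{u, v} \<noteq> {d, y}"
        "u = c \<or> u = x" "v = d \<or> v = y"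
      unfolding have_common_edge_def by auto
    then have "l u \<le> r v" "l v \<le> r u" "u \<noteq> v" using n[of u v] V by auto
    with uv b show False by (auto simp: insert_commute)
  qed
qed

text \<open>Indexed because the program outputs edges by position; injectivity turns the number of
  positions into the size of the packing.\<close>

lemma pairwise_before_edge_open_packing:
  assumes rep: "interval_representation V E l r" and G: "simple_graph V E"
    and E: "\<And>i. i \<in> I \<Longrightarrow> {u i, v i} \<in> E"
    and b: "\<And>i j. \<lbrakk>i \<in> I; j \<in> I; i \<noteq> j\<rbrakk> \<Longrightarrow>
              before l r (u i, v i) (u j, v j) \<or> before l r (u j, v j) (u i, v i)"
  shows "edge_open_packing E ((\<lambda>i. {u i, v i}) ` I)" "inj_on (\<lambda>i. {u i, v i}) I"
proof -
  have *: "{u i, v i} \<noteq> {u j, v j} \<and> \<not> have_common_edge E {u i, v i} {u j, v j}"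
    if "i \<in> I" "j \<in> I" "i \<noteq> j" for i j
    using b[OF that] before_no_common_edge[OF rep G] E[OF that(1)] E[OF that(2)]
      have_common_edge_sym by metis
  show "edge_open_packing E ((\<lambda>i. {u i, v i}) ` I)"
    unfolding edge_open_packing_def
  proof (intro conjI ballI impI)
    show "(\<lambda>i. {u i, v i}) ` I \<subseteq> E" using E by blast
    fix e f assume "e \<in> (\<lambda>i. {u i, v i}) ` I" "f \<in> (\<lambda>i. {u i, v i}) ` I" "e \<noteq> f"
    then obtain i j where "i \<in> I" "j \<in> I" "e = {u i, v i}" "f = {u j, v j}" "i \<noteq> j" by blast
    with *[of i j] show "\<not> have_common_edge E e f" by simp
  qed
  show "inj_on (\<lambda>i. {u i, v i}) I"
    using * by (meson inj_onI)
qed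

section \<open>From edge open packings to chains\<close>

text \<open>No cross pair is adjacent, and the intervals of two adjacent vertices unite to an
  interval. So one union lies entirely to the left of the other, whichever endpoints are called
  centres.\<close>

lemma disjoint_edges_before:
  assumes rep: "interval_representation V E l r" and G: "simple_graph V E"
    and e: "{c, x} \<in> E" and f: "{d, y} \<in> E" and dis: "{c, x} \<inter> {d, y} = {}"
    and nc: "\<not> have_common_edge E {c, x} {d, y}"
  shows "before l r (c, x) (d, y) \<or> before l r (d, y) (c, x)"
proof -
  note adj = interval_adjacent_iff[OF rep G]
  have V: "c \<in> V" "x \<in> V" "d \<in> V" "y \<in> V"
    using simple_graphD[OF G] e f by blast+
  have "{u, v} \<notin> E" if "u \<in> {c, x}" "v \<in> {d, y}" for u v
  proof
    assume "{u, v} \<in> E"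
    moreover have "{u, v} \<noteq> {c, x}" "{u, v} \<noteq> {d, y}"
      using that dis by (auto simp: doubleton_eq_iff)
    ultimately show False using nc that unfolding have_common_edge_def by blast
  qed
  then have "\<not> (l c \<le> r d \<and> l d \<le> r c)" "\<not> (l c \<le> r y \<and> l y \<le> r c)"
      "\<not> (l x \<le> r d \<and> l d \<le> r x)" "\<not> (l x \<le> r y \<and> l y \<le> r x)"
    using adj V dis by auto
  moreover have "l c \<le> r x" "l x \<le> r c" "l d \<le> r y" "l y \<le> r d"
    using e f adj V by auto
  moreover have "l v \<le> r v" if "v \<in> V" for v
    using rep that unfolding interval_representation_def by auto
  then have "l c \<le> r c" "l x \<le> r x" "l d \<le> r d" "l y \<le> r y" using V by auto
  ultimately have "r c < l d \<and> r c < l y \<and> r x < l d \<and> r x < l y \<or>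
      r d < l c \<and> r d < l x \<and> r y < l c \<and> r y < l x"
    by (cases "r c < l d"; cases "r c < l y"; cases "r x < l d"; cases "r x < l y"; simp)
  then show ?thesis by auto
qed

text \<open>
  If both endpoints of an edge were shared with further edges of the packing, this edge would be a
  common edge of the two; hence one endpoint is private, and it is chosen as the leaf.
\<close>

lemma edge_open_packing_orientation:
  assumes rep: "interval_representation V E l r" and G: "simple_graph V E"
    and D: "edge_open_packing E D"
  obtains c x where "\<And>e. e \<in> D \<Longrightarrow> e = {c e, x e}"
    and "\<And>e f. \<lbrakk>e \<in> D; f \<in> D; e \<noteq> f\<rbrakk> \<Longrightarrow>
           before l r (c e, x e) (c f, x f) \<or> before l r (c f, x f) (c e, x e)"
proof -
  note adj = interval_adjacent_iff[OF rep G]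
  have DE: "D \<subseteq> E" and nc: "\<And>e f. \<lbrakk>e \<in> D; f \<in> D; e \<noteq> f\<rbrakk> \<Longrightarrow> \<not> have_common_edge E e f"
    using D unfolding edge_open_packing_def by auto
  have "\<exists>c x. e = {c, x} \<and> (\<forall>f\<in>D. f \<noteq> e \<longrightarrow> x \<notin> f)" if e: "e \<in> D" for e
  proof -
    from e DE G have "card e = 2" unfolding simple_graph_def by auto
    then obtain u v where uv: "e = {u, v}" "u \<noteq> v" by (meson card_2_iff)
    have False if f: "f \<in> D" "f \<noteq> e" "u \<in> f" and g: "g \<in> D" "g \<noteq> e" "v \<in> g" for f g
    proof -
      \<comment> \<open>Were \<open>f = g\<close>, this two-element set would contain both
        \<open>u\<close> and \<open>v\<close> and hence equal \<open>e\<close>.\<close>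
      have "card f = 2" using f DE G unfolding simple_graph_def by auto
      then have "f \<noteq> g"
        using f g uv by (auto simp: card_2_iff)
      moreover have "have_common_edge E f g"
        unfolding have_common_edge_def using e f g uv DE by blast
      ultimately show False using nc f g by blast
    qed
    then have "(\<forall>f\<in>D. f \<noteq> e \<longrightarrow> u \<notin> f) \<or> (\<forall>f\<in>D. f \<noteq> e \<longrightarrow> v \<notin> f)" by blast
    then show ?thesis using uv by (metis insert_commute)
  qed
  then have "\<forall>e\<in>D. \<exists>p. e = {fst p, snd p} \<and> (\<forall>f\<in>D. f \<noteq> e \<longrightarrow> snd p \<notin> f)" by simp
  from bchoice[OF this] obtain q where
    q: "\<forall>e\<in>D. e = {fst (q e), snd (q e)} \<and> (\<forall>f\<in>D. f \<noteq> e \<longrightarrow> snd (q e) \<notin> f)" by blast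
  define c x where "c e = fst (q e)" and "x e = snd (q e)" for e
  have cx: "e = {c e, x e}" if "e \<in> D" for e
    using q that unfolding c_def x_def by blast
  have leaf: "x e \<notin> f" if "e \<in> D" "f \<in> D" "f \<noteq> e" for e f
    using q that unfolding x_def by blast
  have "before l r (c e, x e) (c f, x f) \<or> before l r (c f, x f) (c e, x e)"
    if ef: "e \<in> D" "f \<in> D" "e \<noteq> f" for e f
  proof (cases "c e = c f")
    case True
    have "{c e, x e} \<in> E" "{c f, x f} \<in> E" using cx ef DE by auto
    then have V: "x e \<in> V" "x f \<in> V" using simple_graphD[OF G] by blast+
    \<comment> \<open>Since leaves are private, an edge between the two leaves would be a third edge
      and thus a common edge.\<close>
    have "{x e, x f} \<noteq> e" "{x e, x f} \<noteq> f"
      using leaf[OF ef(1,2)] leaf[OF ef(2,1)] ef by blast+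
    then have "{x e, x f} \<notin> E"
      using nc[OF ef] cx[OF ef(1)] cx[OF ef(2)] unfolding have_common_edge_def by blast
    moreover have "x e \<noteq> x f" using leaf[OF ef(1,2)] ef cx[OF ef(2)] by auto
    ultimately show ?thesis using adj[OF V] True by auto
  next
    case False
    have eq: "{c e, x e} = e" "{c f, x f} = f" using cx ef by auto
    have "x e \<notin> {c f, x f}" "x f \<notin> {c e, x e}"
      unfolding eq using leaf ef by auto
    \<comment> \<open>Neither leaf lies in the other edge, so the edges could only meet in their
      centres.\<close>
    with False have "{c e, x e} \<inter> {c f, x f} = {}" by auto
    then show ?thesis
      by (intro disjoint_edges_before[OF rep G]) (use eq nc[OF ef] ef DE in auto)
  qed
  with cx show ?thesis using that by blast
qed

section \<open>Running times of programs\<close>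

text \<open>Total correctness from one start state. An upper bound replaces the exact time so that
  branches and rounds of different cost can be combined.\<close>

definition halts :: "reals \<Rightarrow> com \<Rightarrow> mem \<Rightarrow> nat \<Rightarrow> (mem \<Rightarrow> bool) \<Rightarrow> bool" where
  "halts \<rho> c s t Q \<longleftrightarrow> (\<exists>t' s'. exec \<rho> c s t' s' \<and> t' \<le> t \<and> Q s')"

fun loop_free :: "com \<Rightarrow> bool" where
  "loop_free (Seq c d) \<longleftrightarrow> loop_free c \<and> loop_free d"
| "loop_free (If b c d) \<longleftrightarrow> loop_free c \<and> loop_free d"
| "loop_free (While b c) \<longleftrightarrow> False"
| "loop_free c \<longleftrightarrow> True"

text \<open>Loop-free pieces are executed symbolically by simplification. The last equation also
  covers \<open>While\<close>, where the value is a dummy; \<open>exec_loop_free\<close> excludes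
  that case.\<close>

fun result :: "reals \<Rightarrow> com \<Rightarrow> mem \<Rightarrow> mem" where
  "result \<rho> (Assign a i e) s = s(a := (s a)(aval i s := aval e s))"
| "result \<rho> (Seq c d) s = result \<rho> d (result \<rho> c s)"
| "result \<rho> (If b c d) s = (if bval \<rho> b s then result \<rho> c s else result \<rho> d s)"
| "result \<rho> c s = s"

fun ccost :: "com \<Rightarrow> nat" where
  "ccost (Assign a i e) = 1 + acost i + acost e"
| "ccost (Seq c d) = ccost c + ccost d"
| "ccost (If b c d) = 1 + bcost b + max (ccost c) (ccost d)"
| "ccost c = 1"

lemma exec_loop_free: "loop_free c \<Longrightarrow> \<exists>t. exec \<rho> c s t (result \<rho> c s) \<and> t \<le> ccost c"
proof (induction c arbitrary: s)
  case (Seq c d)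
  then obtain t t' where "exec \<rho> c s t (result \<rho> c s)" "t \<le> ccost c"
      "exec \<rho> d (result \<rho> c s) t' (result \<rho> d (result \<rho> c s))" "t' \<le> ccost d"
    by fastforce
  then show ?case using exec.Seq by (fastforce intro: add_mono)
next
  case (If b c d)
  show ?case
  proof (cases "bval \<rho> b s")
    case True
    from If obtain t where "exec \<rho> c s t (result \<rho> c s)" "t \<le> ccost c" by fastforce
    then show ?thesis using True
      by (intro exI[of _ "1 + bcost b + t"]) (auto intro: exec.IfTrue[simplified])
  next
    case False
    from If obtain t where "exec \<rho> d s t (result \<rho> d s)" "t \<le> ccost d" by fastforce
    then show ?thesis using False
      by (intro exI[of _ "1 + bcost b + t"]) (auto intro: exec.IfFalse[simplified])
  qed
qed (auto intro: exec.intros exec.Assign[simplified] exec.Skip[simplified])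

lemma halts_loop_free:
  "\<lbrakk>loop_free c; ccost c \<le> t; Q (result \<rho> c s)\<rbrakk> \<Longrightarrow> halts \<rho> c s t Q"
  unfolding halts_def using exec_loop_free by (meson le_trans)

lemma halts_Seq:
  assumes "halts \<rho> c s t Q" "\<And>s. Q s \<Longrightarrow> halts \<rho> d s t' Q'"
  shows "halts \<rho> (Seq c d) s (t + t') Q'"
  using assms unfolding halts_def by (meson add_mono exec.Seq)

lemma halts_mono:
  "\<lbrakk>halts \<rho> c s t Q; t \<le> t'; \<And>s. Q s \<Longrightarrow> Q' s\<rbrakk> \<Longrightarrow> halts \<rho> c s t' Q'"
  unfolding halts_def by (meson le_trans)

abbreviation var :: "name \<Rightarrow> aexp" where
  "var v \<equiv> Cell v (Num 0)"

definition For :: "name \<Rightarrow> aexp \<Rightarrow> com \<Rightarrow> com" where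
  "For v B c = Seq (Assign v (Num 0) (Num 0))
     (While (Less (var v) B) (Seq c (Assign v (Num 0) (Plus (var v) (Num 1)))))"

text \<open>The loop variable is part of the state, so the invariant has to be stable under setting it.\<close>

lemma halts_For:
  assumes init: "I 0 (s(v := (s v)(0 := 0)))"
    and bound: "\<And>k s. I k s \<Longrightarrow> aval B s = N"
    and body: "\<And>k s. \<lbrakk>k < N; I k s; s v 0 = k\<rbrakk> \<Longrightarrow>
      halts \<rho> c s t (\<lambda>s'. s' v 0 = k \<and> I (Suc k) (s'(v := (s' v)(0 := Suc k))))"
  shows "halts \<rho> (For v B c) s (7 + acost B + N * (10 + acost B + t)) (I N)"
proof -
  let ?W = "While (Less (var v) B) (Seq c (Assign v (Num 0) (Plus (var v) (Num 1))))"
  \<comment> \<open>Induction on the number \<open>j\<close> of remaining rounds. A test costs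
    \<open>4 + acost B\<close> and the increment 6; the initial assignment later adds 3.\<close>
  have W: "halts \<rho> ?W s (4 + acost B + j * (10 + acost B + t)) (I N)"
    if "I k s" "s v 0 = k" "k + j = N" for j k s
    using that
  proof (induction j arbitrary: k s)
    case 0
    then have "\<not> bval \<rho> (Less (var v) B) s" using bound by simp
    from exec.WhileFalse[OF this] 0 show ?case unfolding halts_def by fastforce
  next
    case (Suc j)
    then have b: "bval \<rho> (Less (var v) B) s" using bound by simp
    from body[of k s] Suc.prems obtain t1 s1 where 1: "exec \<rho> c s t1 s1" "t1 \<le> t"
        "s1 v 0 = k" "I (Suc k) (s1(v := (s1 v)(0 := Suc k)))"
      unfolding halts_def by auto
    let ?s2 = "s1(v := (s1 v)(0 := Suc k))"
    have "exec \<rho> (Assign v (Num 0) (Plus (var v) (Num 1))) s1 6 ?s2"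
      using exec.Assign[of \<rho> v "Num 0" "Plus (var v) (Num 1)" s1] 1(3) by (simp add: numeral_eq_Suc)
    from exec.Seq[OF 1(1) this]
    have 2: "exec \<rho> (Seq c (Assign v (Num 0) (Plus (var v) (Num 1)))) s (t1 + 6) ?s2" .
    have "?s2 v 0 = Suc k" "Suc k + j = N" using Suc.prems by auto
    from Suc.IH[OF 1(4) this] obtain t3 s3 where 3: "exec \<rho> ?W ?s2 t3 s3"
        "t3 \<le> 4 + acost B + j * (10 + acost B + t)" "I N s3"
      unfolding halts_def by blast
    have "exec \<rho> ?W s (1 + bcost (Less (var v) B) + (t1 + 6) + t3) s3"
      by (rule exec.WhileTrue[OF b 2 3(1)])
    moreover have "1 + bcost (Less (var v) B) + (t1 + 6) + t3 \<le>
        4 + acost B + Suc j * (10 + acost B + t)"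
      using 1(2) 3(2) by simp
    ultimately show ?case unfolding halts_def using 3(3) by blast
  qed
  let ?s = "s(v := (s v)(0 := 0))"
  have "halts \<rho> (Assign v (Num 0) (Num 0)) s 3 (\<lambda>s'. s' = ?s)"
    by (rule halts_loop_free) auto
  then have "halts \<rho> (For v B c) s (3 + (4 + acost B + N * (10 + acost B + t))) (I N)"
    unfolding For_def by (rule halts_Seq) (use W[of 0 ?s N] init in auto)
  then show ?thesis by (simp add: algebra_simps)
qed

section \<open>The program\<close>

definition orient_edges :: com where
  "orient_edges = For ''i'' (var ''m'')
     (Seq (Assign ''src'' (Plus (var ''m'') (var ''i'')) (Cell ''dst'' (var ''i'')))
          (Assign ''dst'' (Plus (var ''m'') (var ''i'')) (Cell ''src'' (var ''i''))))"

abbreviation size_exp :: aexp where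
  "size_exp \<equiv> Plus (var ''m'') (var ''m'')"

definition swap_edges :: com where
  "swap_edges = Seq (Assign ''h'' (Num 0) (Cell ''src'' (var ''i'')))
     (Seq (Assign ''src'' (var ''i'') (Cell ''src'' (var ''j'')))
     (Seq (Assign ''src'' (var ''j'') (var ''h''))
     (Seq (Assign ''h'' (Num 0) (Cell ''dst'' (var ''i'')))
     (Seq (Assign ''dst'' (var ''i'') (Cell ''dst'' (var ''j'')))
          (Assign ''dst'' (var ''j'') (var ''h''))))))"

text \<open>An exchange sort. As \<open>For\<close> always starts at 0, the guard on
  \<open>i\<close> and \<open>j\<close> restricts the inner loop to later positions.\<close>

definition sort_edges :: com where
  "sort_edges = For ''i'' size_exp (For ''j'' size_exp
     (If (And (Less (var ''i'') (var ''j''))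
              (RLess ''R'' (Cell ''dst'' (var ''j'')) ''R'' (Cell ''dst'' (var ''i''))))
        swap_edges Skip))"

definition Or :: "bexp \<Rightarrow> bexp \<Rightarrow> bexp" where
  "Or b c = Not (And (Not b) (Not c))"

definition Eq :: "aexp \<Rightarrow> aexp \<Rightarrow> bexp" where
  "Eq e f = And (Not (Less e f)) (Not (Less f e))"

abbreviation RL :: "name \<Rightarrow> name \<Rightarrow> bexp" where
  "RL a b \<equiv> RLess ''R'' (Cell a (var ''j'')) ''L'' (Cell b (var ''i''))"

definition before_exp :: bexp where
  "before_exp = And (RL ''dst'' ''dst'')
     (Or (Eq (Cell ''src'' (var ''j'')) (Cell ''src'' (var ''i'')))
         (And (RL ''src'' ''src'') (And (RL ''src'' ''dst'') (RL ''dst'' ''src''))))"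

text \<open>The cell ''k'' serves both as the running maximum, which relies on its initial value 0,
  and as the size of the output; ''p'' is a position where the maximum is attained.\<close>

definition longest_chains :: com where
  "longest_chains = For ''i'' size_exp
     (Seq (Assign ''b'' (var ''i'') (Num 1))
     (Seq (For ''j'' (var ''i'')
            (If (And before_exp
                     (Not (Less (Cell ''b'' (var ''j'')) (Cell ''b'' (var ''i'')))))
               (Seq (Assign ''b'' (var ''i'') (Plus (Cell ''b'' (var ''j'')) (Num 1)))
                    (Assign ''prev'' (var ''i'') (var ''j'')))
               Skip))
          (If (Less (var ''k'') (Cell ''b'' (var ''i'')))
             (Seq (Assign ''k'' (Num 0) (Cell ''b'' (var ''i'')))
                  (Assign ''p'' (Num 0) (var ''i'')))
             Skip)))"

definition trace_back :: com where
  "trace_back = For ''i'' (var ''k'')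
     (Seq (Assign ''outsrc'' (var ''i'') (Cell ''src'' (var ''p'')))
     (Seq (Assign ''outdst'' (var ''i'') (Cell ''dst'' (var ''p'')))
          (Assign ''p'' (Num 0) (Cell ''prev'' (var ''p'')))))"

definition meop_program :: com where
  "meop_program = Seq orient_edges (Seq sort_edges (Seq longest_chains trace_back))"

lemma bval_Or [simp]: "bval \<rho> (Or b c) s \<longleftrightarrow> bval \<rho> b s \<or> bval \<rho> c s"
  by (simp add: Or_def)

lemma bval_Eq [simp]: "bval \<rho> (Eq e f) s \<longleftrightarrow> aval e s = aval f s"
  by (auto simp: Eq_def)

lemma bval_before_exp:
  "bval \<rho> before_exp s \<longleftrightarrow> before (\<rho> ''L'') (\<rho> ''R'')
     (s ''src'' (s ''j'' 0), s ''dst'' (s ''j'' 0)) (s ''src'' (s ''i'' 0), s ''dst'' (s ''i'' 0))"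
  by (simp add: before_exp_def)

section \<open>Orienting and sorting the edge list\<close>

definition pairs :: "(nat \<Rightarrow> 'a) \<Rightarrow> (nat \<Rightarrow> 'a) \<Rightarrow> nat \<Rightarrow> ('a \<times> 'a) set" where
  "pairs u v N = (\<lambda>i. (u i, v i)) ` {..<N}"

text \<open>That ''k'' is still 0 is recorded for the later search for the maximum.\<close>

lemma orient_edges_correct:
  fixes s0 :: mem
  assumes m: "s0 ''m'' 0 = m" and k: "s0 ''k'' 0 = 0"
  shows "halts \<rho> orient_edges s0 (9 + m * 30) (\<lambda>s.
    s ''m'' 0 = m \<and> s ''k'' 0 = 0 \<and> pairs (s ''src'') (s ''dst'') (m + m) =
      pairs (s0 ''src'') (s0 ''dst'') m \<union> prod.swap ` pairs (s0 ''src'') (s0 ''dst'') m)"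
proof -
  define I where "I k s \<longleftrightarrow> s ''m'' 0 = m \<and> s ''k'' 0 = 0 \<and>
      (\<forall>i<m. s ''src'' i = s0 ''src'' i \<and> s ''dst'' i = s0 ''dst'' i) \<and>
      (\<forall>i<k. s ''src'' (m + i) = s0 ''dst'' i \<and> s ''dst'' (m + i) = s0 ''src'' i)" for k and s :: mem
  \<comment> \<open>Each of the two assignments of the body costs 9, which gives the 18.\<close>
  have "halts \<rho> orient_edges s0 (7 + acost (var ''m'') + m * (10 + acost (var ''m'') + 18)) (I m)"
    unfolding orient_edges_def
  proof (rule halts_For)
    show "I 0 (s0(''i'' := (s0 ''i'')(0 := 0)))" using m k by (simp add: I_def)
  next
    fix j s assume "j < m" "I j s" "s ''i'' 0 = j"
    then show "halts \<rho> (Seq (Assign ''src'' (Plus (var ''m'') (var ''i'')) (Cell ''dst'' (var ''i'')))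
          (Assign ''dst'' (Plus (var ''m'') (var ''i'')) (Cell ''src'' (var ''i'')))) s 18
          (\<lambda>s'. s' ''i'' 0 = j \<and> I (Suc j) (s'(''i'' := (s' ''i'')(0 := Suc j))))"
      by (intro halts_loop_free) (auto simp: I_def less_Suc_eq)
  qed (auto simp: I_def)
  then show ?thesis
  proof (rule halts_mono)
    fix s assume I: "I m s"
    have "{..<m + m} = {..<m} \<union> (+) m ` {..<m}"
      by (simp add: lessThan_atLeast0 ivl_disj_un_two(3))
    then have "pairs (s ''src'') (s ''dst'') (m + m) =
        pairs (s0 ''src'') (s0 ''dst'') m \<union> prod.swap ` pairs (s0 ''src'') (s0 ''dst'') m"
      using I unfolding pairs_def I_def by (simp add: image_Un image_image)
    then show "s ''m'' 0 = m \<and> s ''k'' 0 = 0 \<and> pairs (s ''src'') (s ''dst'') (m + m) =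
        pairs (s0 ''src'') (s0 ''dst'') m \<union> prod.swap ` pairs (s0 ''src'') (s0 ''dst'') m"
      using I by (simp add: I_def)
  qed simp
qed

text \<open>Swapping two positions in both arrays is composition with a transposition, which
  permutes the index set.\<close>

lemma pairs_swap:
  assumes "i < N" "j < N"
  shows "pairs (u(i := u j, j := u i)) (v(i := v j, j := v i)) N = pairs u v N"
proof -
  have "pairs (u(i := u j, j := u i)) (v(i := v j, j := v i)) N =
      (\<lambda>a. (u a, v a)) ` Transposition.transpose i j ` {..<N}"
    unfolding pairs_def image_image
    by (rule image_cong) (auto simp: Transposition.transpose_def)
  also have "Transposition.transpose i j ` {..<N} = {..<N}"
    using assms by (intro transpose_image_eq) auto
  finally show ?thesis by (simp only: pairs_def)
qed

text \<open>The index \<open>b\<close> ranges up to \<open>N\<close> and not only up to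
  \<open>k\<close>: the first \<open>k\<close> positions are final, since nothing behind them is
  smaller.\<close>

definition sorted_upto :: "('a \<Rightarrow> real) \<Rightarrow> nat \<Rightarrow> nat \<Rightarrow> (nat \<Rightarrow> 'a) \<Rightarrow> bool" where
  "sorted_upto r N k d \<longleftrightarrow> (\<forall>a<k. \<forall>b<N. a < b \<longrightarrow> r (d a) \<le> r (d b))"

lemma sorted_upto_swap:
  assumes "sorted_upto r N i d" "i < j" "j < N"
  shows "sorted_upto r N i (d(i := d j, j := d i))"
  using assms unfolding sorted_upto_def by auto

lemma sorted_upto_Suc:
  assumes "sorted_upto r N i d" "\<And>b. \<lbrakk>b < N; i < b\<rbrakk> \<Longrightarrow> r (d i) \<le> r (d b)"
  shows "sorted_upto r N (Suc i) d"
  using assms unfolding sorted_upto_def by (auto simp: less_Suc_eq)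

lemma result_swap_edges:
  assumes "s ''i'' 0 = i" "s ''j'' 0 = j"
  shows "result \<rho> swap_edges s ''src'' = (s ''src'')(i := s ''src'' j, j := s ''src'' i)"
    and "result \<rho> swap_edges s ''dst'' = (s ''dst'')(i := s ''dst'' j, j := s ''dst'' i)"
    and "a \<notin> {''h'', ''src'', ''dst''} \<Longrightarrow> result \<rho> swap_edges s a = s a"
  using assms by (auto simp: swap_edges_def)

lemma sort_edges_correct:
  fixes s0 :: mem
  assumes m: "s0 ''m'' 0 = m" and k: "s0 ''k'' 0 = 0" and N: "N = m + m"
  shows "halts \<rho> sort_edges s0 (12 + N * (27 + N * 61)) (\<lambda>s.
    s ''m'' 0 = m \<and> s ''k'' 0 = 0 \<and>
    pairs (s ''src'') (s ''dst'') N = pairs (s0 ''src'') (s0 ''dst'') N \<and>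
    sorted_upto (\<rho> ''R'') N N (s ''dst''))"
proof -
  let ?r = "\<rho> ''R''"
  define I where "I k s \<longleftrightarrow> s ''m'' 0 = m \<and> s ''k'' 0 = 0 \<and>
      pairs (s ''src'') (s ''dst'') N = pairs (s0 ''src'') (s0 ''dst'') N \<and>
      sorted_upto ?r N k (s ''dst'')" for k and s :: mem
  \<comment> \<open>Inner invariant: position \<open>i\<close> holds a smallest right endpoint among
    the positions from \<open>i\<close> up to \<open>j - 1\<close>.\<close>
  define J where "J i j s \<longleftrightarrow> s ''i'' 0 = i \<and> I i s \<and>
      (\<forall>b<j. i < b \<longrightarrow> ?r (s ''dst'' i) \<le> ?r (s ''dst'' b))" for i j and s :: mem
  let ?body = "If (And (Less (var ''i'') (var ''j''))
              (RLess ''R'' (Cell ''dst'' (var ''j'')) ''R'' (Cell ''dst'' (var ''i''))))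
        swap_edges Skip"
  have I_upd: "I k (s(v := x)) \<longleftrightarrow> I k s" if "v = ''i'' \<or> v = ''j''" for k s v x
    using that by (auto simp: I_def)
  \<comment> \<open>The 46 consists of 14 for the conditional and its test and 32 for the six
    assignments of a swap.\<close>
  have body: "halts \<rho> ?body s 46 (\<lambda>s'. s' ''j'' 0 = j \<and> J i (Suc j) (s'(''j'' := (s' ''j'')(0 := Suc j))))"
    if "j < N" and J: "J i j s" and j: "s ''j'' 0 = j" and "i < N" for i j s
  proof (rule halts_loop_free)
    define s' where "s' = result \<rho> ?body s"
    have i: "s ''i'' 0 = i" using J by (simp add: J_def)
    note sw = result_swap_edges[where s = s and i = i and j = j and \<rho> = \<rho>, OF i j]
    have "s' ''j'' 0 = j \<and> J i (Suc j) (s'(''j'' := (s' ''j'')(0 := Suc j)))"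
    proof (cases "i < j \<and> ?r (s ''dst'' j) < ?r (s ''dst'' i)")
      case True
      then have s: "s' = result \<rho> swap_edges s" using i j by (simp add: s'_def)
      have "pairs (s' ''src'') (s' ''dst'') N = pairs (s ''src'') (s ''dst'') N"
        unfolding s sw(1,2) using \<open>i < N\<close> \<open>j < N\<close> by (rule pairs_swap)
      moreover have "sorted_upto ?r N i (s' ''dst'')"
        unfolding s sw(2) using J True \<open>j < N\<close> by (intro sorted_upto_swap) (auto simp: J_def I_def)
      ultimately have "I i s'"
        using J by (simp add: J_def I_def s sw(3))
      moreover have "\<forall>b<Suc j. i < b \<longrightarrow> ?r (s' ''dst'' i) \<le> ?r (s' ''dst'' b)"
        using J True unfolding s sw(2) by (auto simp: J_def less_Suc_eq)
      ultimately show ?thesis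
        using i j by (simp add: J_def I_upd s sw(3))
    next
      case False
      then have s: "s' = s" using i j by (auto simp: s'_def)
      show ?thesis
        using J False j unfolding s by (auto simp: J_def I_upd less_Suc_eq)
    qed
    then show "result \<rho> ?body s ''j'' 0 = j \<and>
        J i (Suc j) ((result \<rho> ?body s)(''j'' := (result \<rho> ?body s ''j'')(0 := Suc j)))"
      unfolding s'_def .
  qed (simp_all add: swap_edges_def)
  have inner: "halts \<rho> (For ''j'' size_exp ?body) s (7 + acost size_exp + N * (10 + acost size_exp + 46)) (J i N)"
    if "I i s" "s ''i'' 0 = i" "i < N" for i s
  proof (rule halts_For)
    show "J i 0 (s(''j'' := (s ''j'')(0 := 0)))" using that by (simp add: J_def I_upd)
  next
    show "aval size_exp s = N" if "J i j s" for j s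
      using that by (simp add: J_def I_def N)
  qed (use body that in blast)
  have "halts \<rho> sort_edges s0 (7 + acost size_exp + N * (10 + acost size_exp + (12 + N * 61))) (I N)"
    unfolding sort_edges_def
  proof (rule halts_For)
    show "I 0 (s0(''i'' := (s0 ''i'')(0 := 0)))"
      using m k by (simp add: I_upd) (simp add: I_def sorted_upto_def)
  next
    show "aval size_exp s = N" if "I i s" for i s
      using that by (simp add: I_def N)
  next
    fix i s assume "i < N" "I i s" "s ''i'' 0 = i"
    from inner[OF this(2,3,1)]
    show "halts \<rho> (For ''j'' size_exp ?body) s (12 + N * 61)
        (\<lambda>s'. s' ''i'' 0 = i \<and> I (Suc i) (s'(''i'' := (s' ''i'')(0 := Suc i))))"
    proof (rule halts_mono)
      fix s' assume J: "J i N s'"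
      then have "sorted_upto ?r N (Suc i) (s' ''dst'')"
        by (intro sorted_upto_Suc) (auto simp: J_def I_def)
      with J show "s' ''i'' 0 = i \<and> I (Suc i) (s'(''i'' := (s' ''i'')(0 := Suc i)))"
        by (simp add: I_upd) (simp add: J_def I_def)
    qed simp
  qed
  then show ?thesis by (rule halts_mono) (simp_all add: I_def)
qed

section \<open>Longest chains by dynamic programming\<close>

text \<open>
  \<open>b i\<close> is the length of a longest chain ending in \<open>i\<close> and \<open>q i\<close> the predecessor of \<open>i\<close> in such a
  chain; \<open>B\<close> is the chain order on indices.
\<close>

definition link :: "(nat \<Rightarrow> nat \<Rightarrow> bool) \<Rightarrow> (nat \<Rightarrow> nat) \<Rightarrow> (nat \<Rightarrow> nat) \<Rightarrow> nat \<Rightarrow> bool" where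
  "link B b q i \<longleftrightarrow> b i = 1 \<or> q i < i \<and> B (q i) i \<and> b i = Suc (b (q i))"

text \<open>Both halves of optimality: \<open>link\<close> yields a chain of length
  \<open>b i\<close> ending in \<open>i\<close>, and the inequality shows that no chain of
  increasing positions ending there is longer.\<close>

definition chain_lengths ::
  "(nat \<Rightarrow> nat \<Rightarrow> bool) \<Rightarrow> nat \<Rightarrow> (nat \<Rightarrow> nat) \<Rightarrow> (nat \<Rightarrow> nat) \<Rightarrow> bool" where
  "chain_lengths B k b q \<longleftrightarrow> (\<forall>i<k. link B b q i \<and> (\<forall>j<i. B j i \<longrightarrow> b j < b i))"

text \<open>Entries below \<open>i\<close> refer only to entries further down, so writing at
  \<open>i\<close> cannot disturb them.\<close>

lemma chain_lengths_upd: "chain_lengths B i (b(i := x)) (q(i := y)) \<longleftrightarrow> chain_lengths B i b q"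
  unfolding chain_lengths_def link_def by (auto split: if_splits)

lemma chain_lengths_upd1: "chain_lengths B i (b(i := x)) q \<longleftrightarrow> chain_lengths B i b q"
  using chain_lengths_upd[of B i b x q "q i"] by simp

text \<open>The lower bound serves to count distinct lengths in \<open>{1..K}\<close>, the upper one
  to bound the running time of \<open>trace_back\<close>.\<close>

lemma chain_lengths_bounds:
  assumes "chain_lengths B N b q" "i < N"
  shows "1 \<le> b i" "b i \<le> Suc i"
proof -
  show "1 \<le> b i" using assms unfolding chain_lengths_def link_def by auto
  show "b i \<le> Suc i" using assms(2)
  proof (induction i rule: less_induct)
    case (less i)
    then have "link B b q i" using assms unfolding chain_lengths_def by blast
    then show ?case using less.IH[of "q i"] less.prems unfolding link_def by auto
  qed
qed

text \<open>The value \<open>K = 0\<close> covers the empty range, where no position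
  \<open>p\<close> exists.\<close>

definition maximum_at :: "nat \<Rightarrow> (nat \<Rightarrow> nat) \<Rightarrow> nat \<Rightarrow> nat \<Rightarrow> bool" where
  "maximum_at N b K p \<longleftrightarrow> (\<forall>i<N. b i \<le> K) \<and> (0 < K \<longrightarrow> p < N \<and> b p = K)"

lemma maximum_at_upd: "maximum_at i (b(i := x)) K p \<longleftrightarrow> maximum_at i b K p"
  unfolding maximum_at_def by auto

lemma maximum_at_Suc:
  "maximum_at i b K p \<Longrightarrow> b i \<le> K \<Longrightarrow> maximum_at (Suc i) b K p"
  "maximum_at i b K p \<Longrightarrow> K < b i \<Longrightarrow> maximum_at (Suc i) b (b i) i"
  unfolding maximum_at_def by (auto simp: less_Suc_eq)

text \<open>Following predecessors from \<open>p\<close> lowers the length by one per step, from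
  \<open>K\<close> down to 1. Transitivity extends the relation from consecutive positions to all
  pairs.\<close>

lemma chain_lengths_trace:
  assumes b: "chain_lengths B N b q" and p: "maximum_at N b K p"
    and trans: "\<And>i j k. \<lbrakk>i < N; j < N; k < N; B i j; B j k\<rbrakk> \<Longrightarrow> B i k"
  shows "a < K \<Longrightarrow> (q ^^ a) p < N \<and> b ((q ^^ a) p) = K - a"
    and "\<lbrakk>a < c; c < K\<rbrakk> \<Longrightarrow> B ((q ^^ c) p) ((q ^^ a) p)"
proof -
  have *: "(q ^^ a) p < N \<and> b ((q ^^ a) p) = K - a" if "a < K" for a
    using that
  proof (induction a)
    case 0
    then show ?case using p unfolding maximum_at_def by simp
  next
    case (Suc a)
    then have "link B b q ((q ^^ a) p)" using b unfolding chain_lengths_def by simp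
    then show ?case using Suc unfolding link_def by auto
  qed
  then show "a < K \<Longrightarrow> (q ^^ a) p < N \<and> b ((q ^^ a) p) = K - a" .
  \<comment> \<open>The length at step \<open>a\<close> is at least 2 here, which rules out the
    first case of \<open>link\<close>.\<close>
  have step: "B ((q ^^ Suc a) p) ((q ^^ a) p)" if "Suc a < K" for a
  proof -
    have "link B b q ((q ^^ a) p)" using b *[of a] that unfolding chain_lengths_def by simp
    then show ?thesis using *[of a] that unfolding link_def by auto
  qed
  show "\<lbrakk>a < c; c < K\<rbrakk> \<Longrightarrow> B ((q ^^ c) p) ((q ^^ a) p)"
  proof (induction c)
    case (Suc c)
    show ?case
    proof (cases "a = c")
      case True
      then show ?thesis using step Suc.prems by simp
    next
      case False
      then have "B ((q ^^ c) p) ((q ^^ a) p)" using Suc by simp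
      then show ?thesis
        using trans[of "(q ^^ Suc c) p" "(q ^^ c) p" "(q ^^ a) p"] step[of c]
          *[of "Suc c"] *[of c] *[of a] Suc.prems by simp
    qed
  qed simp
qed

section \<open>Correctness and cost of the chain computation and the traceback\<close>

lemma longest_chains_correct:
  fixes s0 :: mem
  assumes m: "s0 ''m'' 0 = m" and k: "s0 ''k'' 0 = 0" and N: "N = m + m"
    and B: "\<And>i j. B i j \<longleftrightarrow> before (\<rho> ''L'') (\<rho> ''R'')
              (s0 ''src'' i, s0 ''dst'' i) (s0 ''src'' j, s0 ''dst'' j)"
  shows "halts \<rho> longest_chains s0 (12 + N * (44 + N * 92)) (\<lambda>s.
    s ''src'' = s0 ''src'' \<and> s ''dst'' = s0 ''dst'' \<and> chain_lengths B N (s ''b'') (s ''prev'') \<and>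
    maximum_at N (s ''b'') (s ''k'' 0) (s ''p'' 0))"
proof -
  define F where "F s \<longleftrightarrow> s ''m'' 0 = m \<and> s ''src'' = s0 ''src'' \<and> s ''dst'' = s0 ''dst''" for s :: mem
  define I where "I i s \<longleftrightarrow> F s \<and> chain_lengths B i (s ''b'') (s ''prev'') \<and>
      maximum_at i (s ''b'') (s ''k'' 0) (s ''p'' 0)" for i s
  \<comment> \<open>Inner invariant: the current \<open>b i\<close> is always realised by a chain
    and already exceeds the lengths at all predecessors below \<open>j\<close>.\<close>
  define J where "J i j s \<longleftrightarrow> s ''i'' 0 = i \<and> I i s \<and> link B (s ''b'') (s ''prev'') i \<and>
      (\<forall>a<j. B a i \<longrightarrow> s ''b'' a < s ''b'' i)" for i j s
  let ?init = "Assign ''b'' (var ''i'') (Num 1)"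
  let ?body = "If (And before_exp
                     (Not (Less (Cell ''b'' (var ''j'')) (Cell ''b'' (var ''i'')))))
               (Seq (Assign ''b'' (var ''i'') (Plus (Cell ''b'' (var ''j'')) (Num 1)))
                    (Assign ''prev'' (var ''i'') (var ''j'')))
               Skip"
  let ?max = "If (Less (var ''k'') (Cell ''b'' (var ''i'')))
             (Seq (Assign ''k'' (Num 0) (Cell ''b'' (var ''i'')))
                  (Assign ''p'' (Num 0) (var ''i'')))
             Skip"
  have F_upd: "F (s(v := x)) \<longleftrightarrow> F s" if "v \<notin> {''m'', ''src'', ''dst''}" for s v x
    using that by (auto simp: F_def)
  have I_upd: "I k (s(v := x)) \<longleftrightarrow> I k s" if "v = ''i'' \<or> v = ''j''" for k s v x
    using that by (auto simp: I_def F_upd)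
  \<comment> \<open>The 80 rounds up 75: 62 for the conditional with its test and 13 for the two
    assignments.\<close>
  have body: "halts \<rho> ?body s 80 (\<lambda>s'. s' ''j'' 0 = j \<and> J i (Suc j) (s'(''j'' := (s' ''j'')(0 := Suc j))))"
    if "j < i" and J: "J i j s" and j: "s ''j'' 0 = j" for i j s
  proof (rule halts_loop_free)
    define s' where "s' = result \<rho> ?body s"
    have i: "s ''i'' 0 = i" and F: "F s" using J by (simp_all add: J_def I_def)
    have before: "bval \<rho> before_exp s \<longleftrightarrow> B j i"
      using F i j by (simp add: bval_before_exp B F_def)
    have "s' ''j'' 0 = j \<and> J i (Suc j) (s'(''j'' := (s' ''j'')(0 := Suc j)))"
    proof (cases "B j i \<and> s ''b'' i \<le> s ''b'' j")
      case True
      let ?b = "(s ''b'')(i := Suc (s ''b'' j))" and ?q = "(s ''prev'')(i := j)"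
      have s: "s' = s(''b'' := ?b, ''prev'' := ?q)"
        using True before i j by (auto simp: s'_def)
      have "I i s'"
        using J unfolding s by (simp add: J_def I_def F_upd chain_lengths_upd maximum_at_upd)
      moreover have "link B ?b ?q i" using True \<open>j < i\<close> by (simp add: link_def)
      \<comment> \<open>The new value at \<open>i\<close> exceeds the old one, so the inequalities
        for positions below \<open>j\<close> survive.\<close>
      moreover have "\<forall>a<Suc j. B a i \<longrightarrow> ?b a < ?b i"
        using J True \<open>j < i\<close> by (auto simp: J_def less_Suc_eq)
      ultimately show ?thesis using i j by (simp add: J_def I_upd s)
    next
      case False
      then have s: "s' = s" using before i j by (auto simp: s'_def)
      show ?thesis
        using J False j unfolding s by (auto simp: J_def I_upd less_Suc_eq)
    qed
    then show "result \<rho> ?body s ''j'' 0 = j \<and>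
        J i (Suc j) ((result \<rho> ?body s)(''j'' := (result \<rho> ?body s ''j'')(0 := Suc j)))"
      unfolding s'_def .
  qed (simp_all add: before_exp_def Or_def Eq_def)
  have inner: "halts \<rho> (For ''j'' (var ''i'') ?body) s (9 + N * 92) (J i i)"
    if J: "J i 0 s" and "i < N" for i s
  proof -
    have "halts \<rho> (For ''j'' (var ''i'') ?body) s
        (7 + acost (var ''i'') + i * (10 + acost (var ''i'') + 80)) (J i i)"
    proof (rule halts_For[where I = "J i" and N = i])
      show "J i 0 (s(''j'' := (s ''j'')(0 := 0)))" using J by (simp add: J_def I_upd)
      show "aval (var ''i'') s = i" if "J i j s" for j s
        using that by (simp add: J_def)
    qed (use body in blast)
    then show ?thesis by (rule halts_mono) (use \<open>i < N\<close> in simp_all)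
  qed
  have final: "halts \<rho> ?max s 16 (\<lambda>s'. s' ''i'' 0 = i \<and> I (Suc i) (s'(''i'' := (s' ''i'')(0 := Suc i))))"
    if J: "J i i s" for i s
  proof -
    have "chain_lengths B (Suc i) (s ''b'') (s ''prev'')"
      using J unfolding J_def I_def chain_lengths_def by (auto simp: less_Suc_eq)
    moreover have "F s" "s ''i'' 0 = i" and "maximum_at i (s ''b'') (s ''k'' 0) (s ''p'' 0)"
      using J by (simp_all add: J_def I_def)
    ultimately show ?thesis
      using maximum_at_Suc by (intro halts_loop_free) (auto simp: I_def F_upd)
  qed
  have "halts \<rho> longest_chains s0 (7 + acost size_exp + N * (10 + acost size_exp + (4 + ((9 + N * 92) + 16)))) (I N)"
    unfolding longest_chains_def
  proof (rule halts_For)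
    show "I 0 (s0(''i'' := (s0 ''i'')(0 := 0)))"
      using m k by (simp add: I_upd) (simp add: I_def F_def chain_lengths_def maximum_at_def)
  next
    show "aval size_exp s = N" if "I i s" for i s
      using that by (simp add: I_def F_def N)
  next
    fix i s assume i: "i < N" "I i s" "s ''i'' 0 = i"
    have "halts \<rho> ?init s 4 (J i 0)"
      using i by (intro halts_loop_free)
        (auto simp: J_def I_def F_upd chain_lengths_upd1 maximum_at_upd link_def)
    then show "halts \<rho> (Seq ?init (Seq (For ''j'' (var ''i'') ?body) ?max)) s (4 + ((9 + N * 92) + 16))
        (\<lambda>s'. s' ''i'' 0 = i \<and> I (Suc i) (s'(''i'' := (s' ''i'')(0 := Suc i))))"
      by (intro halts_Seq[of _ _ _ _ "J i 0"] halts_Seq[of _ _ _ _ "J i i"] inner final i)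
  qed
  then show ?thesis by (rule halts_mono) (simp_all add: I_def F_def)
qed

lemma trace_back_correct:
  fixes s0 :: mem
  assumes "s0 ''k'' 0 = K" "s0 ''p'' 0 = p" "s0 ''prev'' = q"
  shows "halts \<rho> trace_back s0 (9 + K * 29) (\<lambda>s. output_edges s =
    (\<lambda>a. {s0 ''src'' ((q ^^ a) p), s0 ''dst'' ((q ^^ a) p)}) ` {..<K})"
proof -
  define I where "I j s \<longleftrightarrow> s ''k'' 0 = K \<and> s ''p'' 0 = (q ^^ j) p \<and> s ''prev'' = q \<and>
      s ''src'' = s0 ''src'' \<and> s ''dst'' = s0 ''dst'' \<and>
      (\<forall>a<j. s ''outsrc'' a = s0 ''src'' ((q ^^ a) p) \<and> s ''outdst'' a = s0 ''dst'' ((q ^^ a) p))"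
    for j and s :: mem
  have "halts \<rho> trace_back s0 (7 + acost (var ''k'') + K * (10 + acost (var ''k'') + 17)) (I K)"
    unfolding trace_back_def
  proof (rule halts_For)
    show "I 0 (s0(''i'' := (s0 ''i'')(0 := 0)))" using assms by (simp add: I_def)
    show "aval (var ''k'') s = K" if "I j s" for j s using that by (simp add: I_def)
    fix j s assume "j < K" "I j s" "s ''i'' 0 = j"
    then show "halts \<rho> (Seq (Assign ''outsrc'' (var ''i'') (Cell ''src'' (var ''p'')))
        (Seq (Assign ''outdst'' (var ''i'') (Cell ''dst'' (var ''p'')))
          (Assign ''p'' (Num 0) (Cell ''prev'' (var ''p''))))) s 17
        (\<lambda>s'. s' ''i'' 0 = j \<and> I (Suc j) (s'(''i'' := (s' ''i'')(0 := Suc j))))"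
      by (intro halts_loop_free) (simp_all add: I_def less_Suc_eq)
  qed
  then show ?thesis
  proof (rule halts_mono)
    fix s assume "I K s"
    then have "s ''k'' 0 = K" by (simp add: I_def)
    then have "output_edges s = (\<lambda>a. {s ''outsrc'' a, s ''outdst'' a}) ` {..<K}"
      by (auto simp: output_edges_def)
    also have "\<dots> = (\<lambda>a. {s0 ''src'' ((q ^^ a) p), s0 ''dst'' ((q ^^ a) p)}) ` {..<K}"
      using \<open>I K s\<close> by (intro image_cong) (simp_all add: I_def)
    finally show "output_edges s = \<dots>" .
  qed simp
qed

section \<open>Correctness and running time\<close>

text \<open>
  The chain lengths strictly increase along the chain formed by an edge open packing, so they are
  pairwise distinct.
\<close>

lemma card_edge_open_packing_le:
  assumes rep: "interval_representation V E l r" and G: "simple_graph V E"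
    and uv: "pairs u v N = {(c, x). {c, x} \<in> E}"
    and sorted: "sorted_upto r N N v"
    and B: "\<And>i j. B i j \<longleftrightarrow> before l r (u i, v i) (u j, v j)"
    and b: "chain_lengths B N b q" and K: "maximum_at N b K p"
    and D: "edge_open_packing E D"
  shows "card D \<le> K"
proof -
  obtain c x where cx: "\<And>e. e \<in> D \<Longrightarrow> e = {c e, x e}"
    and cmp: "\<And>e f. \<lbrakk>e \<in> D; f \<in> D; e \<noteq> f\<rbrakk> \<Longrightarrow>
           before l r (c e, x e) (c f, x f) \<or> before l r (c f, x f) (c e, x e)"
    using edge_open_packing_orientation[OF rep G D] by metis
  have E: "{c e, x e} \<in> E" if "e \<in> D" for e
    using cx[OF that] D that unfolding edge_open_packing_def by auto
  have "\<forall>e\<in>D. \<exists>i<N. u i = c e \<and> v i = x e"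
  proof
    fix e assume "e \<in> D"
    with E have "(c e, x e) \<in> pairs u v N" unfolding uv by simp
    then show "\<exists>i<N. u i = c e \<and> v i = x e" by (auto simp: pairs_def)
  qed
  from bchoice[OF this] obtain g where
    g: "\<And>e. e \<in> D \<Longrightarrow> g e < N" "\<And>e. e \<in> D \<Longrightarrow> u (g e) = c e" "\<And>e. e \<in> D \<Longrightarrow> v (g e) = x e"
    by auto
  have less: "b (g e) < b (g f)" if ef: "e \<in> D" "f \<in> D" and bef: "before l r (c e, x e) (c f, x f)" for e f
  proof -
    have "x f \<in> V" using simple_graphD(2)[OF G E[OF ef(2)]] .
    then have "l (x f) \<le> r (x f)" using rep unfolding interval_representation_def by auto
    then have "r (v (g e)) < r (v (g f))" using bef g ef by auto
    \<comment> \<open>Here the sorting enters: a strictly larger right endpoint of the leaf forces a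
      later position, so the inequality in \<open>chain_lengths\<close>, which only looks at smaller
      positions, applies.\<close>
    then have "\<not> g f \<le> g e"
      using sorted g(1) ef unfolding sorted_upto_def
      by (metis le_neq_implies_less not_less order_less_irrefl)
    moreover have "B (g e) (g f)" using bef g ef by (simp add: B)
    ultimately show ?thesis using b g(1)[OF ef(2)] unfolding chain_lengths_def by auto
  qed
  have "inj_on (\<lambda>e. b (g e)) D"
  proof (rule inj_onI, rule ccontr)
    fix e f assume "e \<in> D" "f \<in> D" "b (g e) = b (g f)" "e \<noteq> f"
    then show False using less[of e f] less[of f e] cmp[of e f] by auto
  qed
  moreover have "(\<lambda>e. b (g e)) ` D \<subseteq> {1..K}"
  proof clarify
    fix e assume "e \<in> D"
    from chain_lengths_bounds(1)[OF b g(1)[OF this]] K g(1)[OF this]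
    show "b (g e) \<in> {1..K}" unfolding maximum_at_def by simp
  qed
  ultimately show ?thesis using card_inj_on_le[of _ D "{1..K}"] by auto
qed

lemma eop_numberI:
  assumes "finite E" "edge_open_packing E D" "\<And>D'. edge_open_packing E D' \<Longrightarrow> card D' \<le> card D"
  shows "eop_number E = card D"
  unfolding eop_number_def
proof (rule Max_eqI)
  have "{D. edge_open_packing E D} \<subseteq> Pow E" unfolding edge_open_packing_def by auto
  then show "finite (card ` {D. edge_open_packing E D})"
    using \<open>finite E\<close> by (meson finite_Pow_iff finite_imageI finite_subset)
qed (use assms in auto)

text \<open>The traced positions form a chain and hence a packing with \<open>K\<close> distinct
  edges; \<open>card_edge_open_packing_le\<close> shows that no packing is larger.\<close>

lemma optimal_trace:
  assumes rep: "interval_representation V E l r" and G: "simple_graph V E"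
    and uv: "pairs u v N = {(c, x). {c, x} \<in> E}"
    and sorted: "sorted_upto r N N v"
    and B: "\<And>i j. B i j \<longleftrightarrow> before l r (u i, v i) (u j, v j)"
    and b: "chain_lengths B N b q" and K: "maximum_at N b K p"
  defines "D \<equiv> (\<lambda>a. {u ((q ^^ a) p), v ((q ^^ a) p)}) ` {..<K}"
  shows "edge_open_packing E D" "card D = eop_number E"
proof -
  have E: "{u i, v i} \<in> E" if "i < N" for i
  proof -
    have "(u i, v i) \<in> pairs u v N" using that by (simp add: pairs_def)
    then show ?thesis unfolding uv by simp
  qed
  have le: "l (w i) \<le> r (w i)" if "i < N" "w = u \<or> w = v" for i w
    using simple_graphD[OF G E[OF that(1)]] that(2) rep unfolding interval_representation_def by auto
  have trans: "B i k" if "i < N" "j < N" "k < N" "B i j" "B j k" for i j k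
    using that le unfolding B by (blast intro: before_trans)
  have trace1: "(q ^^ a) p < N" if "a < K" for a
    using chain_lengths_trace(1)[OF b K, of a] trans that by blast
  have trace2: "B ((q ^^ c) p) ((q ^^ a) p)" if "a < c" "c < K" for a c
    using chain_lengths_trace(2)[OF b K, of a c] trans that by blast
  have cmp: "before l r (u ((q ^^ i) p), v ((q ^^ i) p)) (u ((q ^^ j) p), v ((q ^^ j) p)) \<or>
      before l r (u ((q ^^ j) p), v ((q ^^ j) p)) (u ((q ^^ i) p), v ((q ^^ i) p))"
    if "i \<in> {..<K}" "j \<in> {..<K}" "i \<noteq> j" for i j
    using trace2[of i j] trace2[of j i] that unfolding B by (cases "i < j") auto
  have edge: "{u ((q ^^ i) p), v ((q ^^ i) p)} \<in> E" if "i \<in> {..<K}" for i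
    using E trace1 that by simp
  show D: "edge_open_packing E D"
    unfolding D_def by (rule pairwise_before_edge_open_packing(1)[OF rep G edge cmp])
  have "inj_on (\<lambda>a. {u ((q ^^ a) p), v ((q ^^ a) p)}) {..<K}"
    by (rule pairwise_before_edge_open_packing(2)[OF rep G edge cmp])
  then have "card D = K"
    unfolding D_def by (simp add: card_image)
  moreover have "finite E"
    using G unfolding simple_graph_def by (meson PowI finite_Pow_iff finite_subset subsetI)
  ultimately show "card D = eop_number E"
    using eop_numberI[OF _ D] card_edge_open_packing_le[OF rep G uv sorted B b K] by simp
qed

text \<open>The input gives each edge in one arbitrary orientation; the swapped copies supply the
  other.\<close>

lemma pairs_input:
  assumes "edge_list E es"
  shows "pairs (input_mem n es ''src'') (input_mem n es ''dst'') (card E) \<union>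
    prod.swap ` pairs (input_mem n es ''src'') (input_mem n es ''dst'') (card E) =
    {(c, x). {c, x} \<in> E}"
proof -
  have len: "length es = card E" and E: "(\<lambda>(u, v). {u, v}) ` set es = E"
    using assms unfolding edge_list_def by auto
  have "pairs (input_mem n es ''src'') (input_mem n es ''dst'') (card E) = (\<lambda>i. es ! i) ` {..<length es}"
    unfolding pairs_def len by (rule image_cong) (auto simp: input_mem_def len)
  also have "\<dots> = set es" by (auto simp: set_conv_nth)
  finally have pairs: "pairs (input_mem n es ''src'') (input_mem n es ''dst'') (card E) = set es" .
  have "{c, x} \<in> E \<longleftrightarrow> (c, x) \<in> set es \<or> (x, c) \<in> set es" for c x
    unfolding E[symmetric] by (auto simp: doubleton_eq_iff image_iff)
  then show ?thesis unfolding pairs by auto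
qed

text \<open>All loops run over edge positions, so the bound depends on \<open>m\<close> alone; the
  added 1 pays for edgeless graphs.\<close>

lemma meop_program_solves:
  "solves_MEOP_on_interval_graphs_in_time meop_program (\<lambda>n m. 842 * (m\<^sup>2 + 1))"
  unfolding solves_MEOP_on_interval_graphs_in_time_def
proof (intro allI impI, elim conjE)
  fix n E es l r
  assume G: "simple_graph {..<n} E" and rep: "interval_representation {..<n} E l r"
    and es: "edge_list E es"
  define m where "m = card E"
  define N where "N = m + m"
  define \<rho> where "\<rho> = input_reals n l r"
  define s0 where "s0 = input_mem n es"
  have rep': "interval_representation {..<n} E (\<rho> ''L'') (\<rho> ''R'')"
    using rep by (rule interval_representation_cong[THEN iffD1, rotated 2])
      (simp_all add: \<rho>_def input_reals_def)
  have m: "s0 ''m'' 0 = m" and k: "s0 ''k'' 0 = 0"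
    using es by (simp_all add: s0_def input_mem_def m_def edge_list_def)
  let ?opt = "\<lambda>s. edge_open_packing E (output_edges s) \<and> card (output_edges s) = eop_number E"
  let ?t = "(9 + m * 30) + ((12 + N * (27 + N * 61)) + ((12 + N * (44 + N * 92)) + (9 + N * 29)))"
  have "halts \<rho> meop_program s0 ?t ?opt"
    unfolding meop_program_def
  proof (rule halts_Seq[OF orient_edges_correct[of s0 m, OF m k]], elim conjE)
    fix s1 assume 1: "s1 ''m'' 0 = m" "s1 ''k'' 0 = 0"
      "pairs (s1 ''src'') (s1 ''dst'') (m + m) =
        pairs (s0 ''src'') (s0 ''dst'') m \<union> prod.swap ` pairs (s0 ''src'') (s0 ''dst'') m"
    show "halts \<rho> (Seq sort_edges (Seq longest_chains trace_back)) s1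
        ((12 + N * (27 + N * 61)) + ((12 + N * (44 + N * 92)) + (9 + N * 29))) ?opt"
    proof (rule halts_Seq[OF sort_edges_correct[of s1 m, OF 1(1,2) N_def]], elim conjE)
      fix s2 assume 2: "s2 ''m'' 0 = m" "s2 ''k'' 0 = 0"
        "pairs (s2 ''src'') (s2 ''dst'') N = pairs (s1 ''src'') (s1 ''dst'') N"
        "sorted_upto (\<rho> ''R'') N N (s2 ''dst'')"
      define B where "B i j \<longleftrightarrow> before (\<rho> ''L'') (\<rho> ''R'')
          (s2 ''src'' i, s2 ''dst'' i) (s2 ''src'' j, s2 ''dst'' j)" for i j
      have uv: "pairs (s2 ''src'') (s2 ''dst'') N = {(c, x). {c, x} \<in> E}"
        using 2(3) 1(3) pairs_input[OF es, of n] by (simp add: N_def s0_def m_def)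
      note optimal = optimal_trace[OF rep' G uv 2(4) B_def]
      show "halts \<rho> (Seq longest_chains trace_back) s2 ((12 + N * (44 + N * 92)) + (9 + N * 29)) ?opt"
      proof (rule halts_Seq[OF longest_chains_correct[of s2 m, OF 2(1,2) N_def B_def]], elim conjE)
        fix s3 assume 3: "s3 ''src'' = s2 ''src''" "s3 ''dst'' = s2 ''dst''"
          and b: "chain_lengths B N (s3 ''b'') (s3 ''prev'')"
          and K: "maximum_at N (s3 ''b'') (s3 ''k'' 0) (s3 ''p'' 0)"
        \<comment> \<open>A chain has at most \<open>N\<close> members, so the traceback stays
          linear in \<open>N\<close>.\<close>
        have "s3 ''k'' 0 \<le> N"
          using K chain_lengths_bounds(2)[OF b, of "s3 ''p'' 0"]
          unfolding maximum_at_def by (cases "s3 ''k'' 0 = 0") auto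
        then show "halts \<rho> trace_back s3 (9 + N * 29) ?opt"
          using optimal[OF b K]
          by (intro halts_mono[OF trace_back_correct[OF refl refl refl]]) (simp_all add: 3)
      qed
    qed
  qed
  moreover have "?t \<le> 842 * (m\<^sup>2 + 1)"
  proof -
    \<comment> \<open>Substituting \<open>N = m + m\<close> yields this polynomial; \<open>m\<close>
      is at most its square, and 842 is 230 + 612.\<close>
    have "42 + 230 * m + 612 * m\<^sup>2 \<le> 842 + 230 * m\<^sup>2 + 612 * m\<^sup>2"
      by (intro add_mono mult_left_mono) (auto simp: power2_eq_square)
    then have "42 + 230 * m + 612 * m\<^sup>2 \<le> 842 * (m\<^sup>2 + 1)" by simp
    moreover have "?t = 42 + 230 * m + 612 * m\<^sup>2"
      by (simp add: N_def power2_eq_square algebra_simps)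
    ultimately show ?thesis by simp
  qed
  ultimately show "\<exists>t s. exec (input_reals n l r) meop_program (input_mem n es) t s \<and>
      t \<le> 842 * ((card E)\<^sup>2 + 1) \<and> ?opt s"
    unfolding halts_def \<rho>_def s0_def m_def by (meson le_trans)
qed

section \<open>The bounds in terms of \<open>n\<close>\<close>

lemma simple_graph_card_edges_le:
  assumes "simple_graph {..<n} E"
  shows "card E \<le> n\<^sup>2"
proof -
  have "E \<subseteq> (\<lambda>(u, v). {u, v}) ` ({..<n} \<times> {..<n})"
  proof
    fix e assume "e \<in> E"
    then have "card e = 2" "e \<subseteq> {..<n}" using assms unfolding simple_graph_def by auto
    then show "e \<in> (\<lambda>(u, v). {u, v}) ` ({..<n} \<times> {..<n})" by (auto simp: card_2_iff)
  qed
  then have "card E \<le> card ({..<n} \<times> {..<n})" by (meson surj_card_le finite_SigmaI finite_lessThan)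
  then show ?thesis by (simp add: power2_eq_square)
qed

text \<open>The bound by \<open>n\<close> and \<open>m\<close> is asked for \<open>n\<close> at
  least 1 because at \<open>n = m = 0\<close> it would be 0, whereas every execution takes at least
  one step.\<close>

theorem theorem9:
  "\<exists>P. (\<exists>T C. solves_MEOP_on_interval_graphs_in_time P T \<and>
              (\<forall>n m. 1 \<le> n \<longrightarrow> T n m \<le> C * (n\<^sup>2 + m\<^sup>2))) \<and>
       (\<exists>T. solves_MEOP_on_interval_graphs_in_time P (\<lambda>n m. T n) \<and>
            (\<lambda>n. real (T n)) \<in> O(\<lambda>n. real n ^ 4))"
proof (intro exI[of _ meop_program] conjI)
  have "842 * (m\<^sup>2 + 1) \<le> 842 * (n\<^sup>2 + m\<^sup>2)" if "1 \<le> n" for n m :: nat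
    using that by simp
  with meop_program_solves
  show "\<exists>T C. solves_MEOP_on_interval_graphs_in_time meop_program T \<and>
      (\<forall>n m. 1 \<le> n \<longrightarrow> T n m \<le> C * (n\<^sup>2 + m\<^sup>2))" by blast
next
  have "842 * ((card E)\<^sup>2 + 1) \<le> 842 * (n ^ 4 + 1)" if "simple_graph {..<n} E" for n E
    using power_mono[OF simple_graph_card_edges_le[OF that], of 2]
    by (simp add: power_mult[symmetric])
  with meop_program_solves
  have "solves_MEOP_on_interval_graphs_in_time meop_program (\<lambda>n m. 842 * (n ^ 4 + 1))"
    unfolding solves_MEOP_on_interval_graphs_in_time_def by (meson le_trans)
  moreover have "(\<lambda>n. real (842 * (n ^ 4 + 1))) \<in> O(\<lambda>n. real n ^ 4)"
  proof (rule bigoI)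
    \<comment> \<open>For \<open>n\<close> at least 1 the added 1 is at most \<open>n ^ 4\<close>,
      which doubles 842 to 1684.\<close>
    have "real (842 * (n ^ 4 + 1)) \<le> 1684 * real n ^ 4" if "1 \<le> n" for n :: nat
      using one_le_power[of "real n" 4] that by simp
    then show "\<forall>\<^sub>F n in sequentially. norm (real (842 * (n ^ 4 + 1))) \<le> 1684 * norm (real n ^ 4)"
      by (intro eventually_sequentiallyI[of 1]) simp
  qed
  ultimately show "\<exists>T. solves_MEOP_on_interval_graphs_in_time meop_program (\<lambda>n m. T n) \<and>
      (\<lambda>n. real (T n)) \<in> O(\<lambda>n. real n ^ 4)"
    by (intro exI[of _ "\<lambda>n. 842 * (n ^ 4 + 1)"] conjI)
qed

end
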